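(* Let $I\supset[0,\infty)$ be an open interval and let $f:I\to(0,\infty)$ be a differentiable function on $I$ such that $f'\in L(a,b)$, where $0\le a<b<\infty$. Let $(\alpha,m)\in(0,1]^2$ and $q\ge1$, and suppose that $|f'(x)|^q$ is $(\alpha,m)$-logarithmically convex on $\left[0,\frac bm\right]$. Put $\eta=|f'(a)|\,/\,\left|f'\left(\frac bm\right)\right|^m$ and $\varphi=\eta^{\alpha q}$. Then: if $\eta=1$, $$\left|\frac{f(a)+f(b)}{2}-\frac1{b-a}\int_a^b f(x)\,dx\right|\le \frac{b-a}{3}\left|f'\left(\tfrac bm\right)\right|^m;$$ if $\eta<1$, $$\left|\frac{f(a)+f(b)}{2}-\frac1{b-a}\int_a^b f(x)\,dx\right|\le \frac{b-a}{2}\left(\frac13\right)^{1-\frac1q}\left|f'\left(\tfrac bm\right)\right|^m\left\{\left[\frac{2\varphi-2}{(\ln\varphi)^3}-\frac{\varphi+1}{(\ln\varphi)^2}-\frac{1-\varphi}{2\ln\varphi}\right]^{\frac1q}+\left[\frac{\varphi-1}{(\ln\varphi)^2}-\frac{\varphi+1}{2\ln\varphi}\right]^{\frac1q}\right\}.$$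
   Context: For $(\alpha,m)\in(0,1]\times(0,1]$ and $c>0$, a function $g:[0,c]\to(0,\infty)$ is $(\alpha,m)$-logarithmically convex on $[0,c]$ if $g(tx+m(1-t)y)\le [g(x)]^{t^\alpha}[g(y)]^{m(1-t^\alpha)}$ for all $x,y\in[0,c]$ and $t\in[0,1]$. In particular such a function is strictly positive. $L(a,b)$ denotes the (Lebesgue) integrable functions on $(a,b)$. *)

theory Defs
  imports "HOL-Analysis.Analysis"
begin

text \<open>
  The parameters are meant to satisfy \<open>0 < \<alpha> \<le> 1\<close>, \<open>0 < m \<le> 1\<close> and \<open>0 < c\<close>. Then
  \<open>t * x + m * (1 - t) * y\<close> again lies in \<open>{0..c}\<close>, and \<open>0 powr \<alpha> = 0\<close> agrees with
  the usual value at \<open>t = 0\<close>. The first conjunct renders the codomain \<open>(0,\<infinity>)\<close>.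
\<close>

definition log_convex_am :: "real \<Rightarrow> real \<Rightarrow> real \<Rightarrow> (real \<Rightarrow> real) \<Rightarrow> bool" where
  "log_convex_am \<alpha> m c g \<longleftrightarrow>
     (\<forall>x\<in>{0..c}. 0 < g x) \<and>
     (\<forall>x\<in>{0..c}. \<forall>y\<in>{0..c}. \<forall>t\<in>{0..1}.
        g (t * x + m * (1 - t) * y)
          \<le> g x powr (t powr \<alpha>) * g y powr (m * (1 - t powr \<alpha>)))"

end

theory Submission
  imports Defs
begin

text \<open>
  Integrating by parts, the trapezoid error is \<open>b - a\<close> times the integral of
  \<open>(1/2 - s) * f' (s * a + (1 - s) * b)\<close> over \<open>[0,1]\<close>, and convexity bounds the derivative by
  \<open>M * exp (l * s)\<close> with \<open>M = \<bar>f' (b / m)\<bar> powr m\<close> and \<open>l = ln \<phi> / q\<close>. Since \<open>f'\<close> never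
  vanishes, it has constant sign (Darboux), so only one half of the kernel counts, and
  \<open>max (1/2 - s) 0 \<le> (1 - s)\<^sup>2 / 2\<close>, where the right-hand side is the mean of \<open>s\<^sup>2 - s + 1/2\<close> and \<open>1/2 - s\<close>. The two
  brackets of the theorem are the integrals of \<open>\<phi> powr s\<close> against these two weights. The power
  \<open>1 / q\<close> is taken out of the first integral by Jensen's inequality; the second weight changes
  sign, so \<open>s\<close> and \<open>1 - s\<close> are paired before applying Jensen.
\<close>

section \<open>Constancy of sign of a nowhere vanishing derivative\<close>

lemma derivative_nonzero_constant_sign:
  fixes f f' :: "real \<Rightarrow> real"
  assumes der: "\<And>x. x \<in> {a..b} \<Longrightarrow> (f has_real_derivative f' x) (at x)"
    and nz: "\<And>x. x \<in> {a..b} \<Longrightarrow> f' x \<noteq> 0"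
  shows "(\<forall>x\<in>{a..b}. 0 < f' x) \<or> (\<forall>x\<in>{a..b}. f' x < 0)"
proof -
  \<comment> \<open>Darboux's argument: \<open>g\<close> rises just to the right of \<open>x\<close>
    and falls just before \<open>y\<close>, so its maximum over \<open>{x..y}\<close> is interior
    and \<open>g'\<close> vanishes there. Keeping \<open>g\<close> general lets \<open>-f\<close>
    handle a change from negative to positive.\<close>
  have no_change: False
    if der: "\<And>x. x \<in> {a..b} \<Longrightarrow> (g has_real_derivative g' x) (at x)"
      and nz: "\<And>x. x \<in> {a..b} \<Longrightarrow> g' x \<noteq> 0"
      and x: "x \<in> {a..b}" "0 < g' x" and y: "y \<in> {a..b}" "g' y < 0" and "x < y"
    for g g' :: "real \<Rightarrow> real" and x y
  proof -
    have "continuous_on {x..y} g"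
      by (rule DERIV_continuous_on[OF has_field_derivative_at_within[OF der]]) (use x y in auto)
    then obtain z where z: "z \<in> {x..y}" and max: "\<And>w. w \<in> {x..y} \<Longrightarrow> g w \<le> g z"
      using continuous_attains_sup[of "{x..y}" g] \<open>x < y\<close> by auto
    obtain d where "d > 0" and d: "\<And>h. 0 < h \<Longrightarrow> h < d \<Longrightarrow> g x < g (x + h)"
      using DERIV_pos_inc_right[OF der[OF x(1)] x(2)] by blast
    define h where "h = min (d / 2) (y - x)"
    have h: "0 < h" "h < d" "h \<le> y - x"
      using \<open>d > 0\<close> \<open>x < y\<close> by (auto simp: h_def)
    have "z \<noteq> x"
      using d[OF h(1,2)] max[of "x + h"] h by auto
    obtain e where "e > 0" and e: "\<And>h. 0 < h \<Longrightarrow> h < e \<Longrightarrow> g y < g (y - h)"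
      using DERIV_neg_dec_left[OF der[OF y(1)] y(2)] by blast
    define k where "k = min (e / 2) (y - x)"
    have k: "0 < k" "k < e" "k \<le> y - x"
      using \<open>e > 0\<close> \<open>x < y\<close> by (auto simp: k_def)
    have "z \<noteq> y"
      using e[OF k(1,2)] max[of "y - k"] k by auto
    have zab: "z \<in> {a..b}" using z x y by auto
    have "g' z = 0"
    proof (rule DERIV_local_max[OF der[OF zab]])
      show "0 < min (z - x) (y - z)" using z \<open>z \<noteq> x\<close> \<open>z \<noteq> y\<close> by auto
      show "\<forall>w. \<bar>z - w\<bar> < min (z - x) (y - z) \<longrightarrow> g w \<le> g z"
        using max by (auto simp: abs_if split: if_splits)
    qed
    with nz[OF zab] show False by simp
  qed
  have False if x: "x \<in> {a..b}" "0 < f' x" and y: "y \<in> {a..b}" "f' y < 0" for x y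
  proof (cases x y rule: linorder_cases)
    case less
    then show ?thesis using no_change[of f f' x y] der nz x y by auto
  next
    case equal
    then show ?thesis using x y by simp
  next
    case greater
    then show ?thesis
      using no_change[of "\<lambda>x. - f x" "\<lambda>x. - f' x" y x] der nz x y
      by (auto intro!: DERIV_minus)
  qed
  then show ?thesis
    using nz by (meson linorder_neqE_linordered_idom)
qed

section \<open>The trapezoid error as an integral of the derivative\<close>

lemma trapezoid_error_has_integral:
  fixes f f' :: "real \<Rightarrow> real"
  assumes "a < b"
    and der: "\<And>x. x \<in> {a..b} \<Longrightarrow> (f has_real_derivative f' x) (at x within {a..b})"
  shows "((\<lambda>s. (1 / 2 - s) * f' (s * a + (1 - s) * b)) has_integral
           ((f a + f b) / 2 - 1 / (b - a) * integral {a..b} f) / (b - a)) {0..1}"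
proof -
  define g where "g s = s * a + (1 - s) * b" for s :: real
  define \<Phi> where "\<Phi> x = integral {a..x} f" for x
  \<comment> \<open>Integration by parts is packed into an antiderivative: \<open>g\<close> has
    slope \<open>a - b\<close>, so the \<open>\<Phi>\<close> term cancels the \<open>f (g s)\<close>
    produced by differentiating \<open>s - 1 / 2\<close>. Existence of the integral then comes
    together with its value.\<close>
  define P where "P s = ((s - 1 / 2) * (f \<circ> g) s + (\<Phi> \<circ> g) s / (b - a)) / (b - a)" for s
  have gab: "g s \<in> {a..b}" if "s \<in> {0..1}" for s
  proof -
    have "s * a \<le> s * b" "(1 - s) * a \<le> (1 - s) * b"
      using that \<open>a < b\<close> by (auto intro!: mult_left_mono)
    then show ?thesis by (simp add: g_def algebra_simps)
  qed
  have cont: "continuous_on {a..b} f"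
    using der by (rule DERIV_continuous_on)
  have dg: "(g has_real_derivative a - b) (at s within {0..1})" for s
    unfolding g_def by (auto intro!: derivative_eq_intros)
  have "(P has_real_derivative (1 / 2 - s) * f' (g s)) (at s within {0..1})"
    if s: "s \<in> {0..1}" for s
  proof -
    have 1: "(f \<circ> g has_real_derivative f' (g s) * (a - b)) (at s within {0..1})"
      by (rule DERIV_image_chain[OF DERIV_subset[OF der] dg]) (use gab s in auto)
    have 2: "(\<Phi> \<circ> g has_real_derivative f (g s) * (a - b)) (at s within {0..1})"
      unfolding \<Phi>_def
      by (rule DERIV_image_chain[OF DERIV_subset[OF integral_has_real_derivative[OF cont]] dg])
        (use gab s in auto)
    have 3: "((\<lambda>s. s - 1 / 2) has_real_derivative 1) (at s within {0..1})"
      by (auto intro!: derivative_eq_intros)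
    have "(P has_real_derivative ((s - 1 / 2) * (f' (g s) * (a - b)) + 1 * (f \<circ> g) s
        + f (g s) * (a - b) / (b - a)) / (b - a)) (at s within {0..1})"
      unfolding P_def by (intro DERIV_cdivide DERIV_add DERIV_mult' 1 2 3)
    moreover have "((s - 1 / 2) * (f' (g s) * (a - b)) + 1 * (f \<circ> g) s
        + f (g s) * (a - b) / (b - a)) / (b - a) = (1 / 2 - s) * f' (g s)"
    proof -
      have "f (g s) * (a - b) / (b - a) = - f (g s)"
        using \<open>a < b\<close> by (simp add: divide_eq_eq algebra_simps)
      then have "((s - 1 / 2) * (f' (g s) * (a - b)) + 1 * (f \<circ> g) s
          + f (g s) * (a - b) / (b - a)) = (1 / 2 - s) * f' (g s) * (b - a)"
        by (simp add: field_simps)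
      then show ?thesis using \<open>a < b\<close> by simp
    qed
    ultimately show ?thesis by simp
  qed
  then have "((\<lambda>s. (1 / 2 - s) * f' (g s)) has_integral P 1 - P 0) {0..1}"
    by (intro fundamental_theorem_of_calculus)
      (auto simp: has_real_derivative_iff_has_vector_derivative[symmetric])
  moreover have "P 1 - P 0 = ((f a + f b) / 2 - 1 / (b - a) * integral {a..b} f) / (b - a)"
    by (simp add: P_def g_def \<Phi>_def diff_divide_distrib add_divide_distrib)
  ultimately show ?thesis
    by (simp add: g_def)
qed

section \<open>Inequalities for concave powers, and Jensen's inequality\<close>

lemma powr_le_tangent:
  fixes x r :: real
  assumes "0 \<le> x" "0 < r" "r \<le> 1"
  shows "x powr r \<le> 1 + r * (x - 1)"
  using Youngs_inequality_0[of r "1 - r" x 1] assms by (cases "x = 0") (auto simp: algebra_simps)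

text \<open>This is subadditivity of the power. After division by \<open>u\<close> the two pieces
  \<open>v / u\<close> and \<open>(u - v) / u\<close> lie in [0,1] and sum to 1, and there
  \<open>t \<le> t powr r\<close>.\<close>

lemma powr_diff_le:
  fixes u v r :: real
  assumes "0 \<le> v" "v \<le> u" "0 < r" "r \<le> 1"
  shows "u powr r - v powr r \<le> (u - v) powr r"
proof (cases "u = 0")
  case False
  then have u: "0 < u" using assms by simp
  have *: "t \<le> t powr r" if "0 \<le> t" "t \<le> 1" for t :: real
    using powr_mono'[of r 1 t] that assms by simp
  have "1 = v / u + (u - v) / u" using u by (simp add: field_simps)
  also have "\<dots> \<le> (v / u) powr r + ((u - v) / u) powr r"
    using u assms by (intro add_mono *) (auto simp: field_simps)
  also have "\<dots> = (v powr r + (u - v) powr r) / u powr r"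
    using u assms by (simp add: powr_divide add_divide_distrib)
  finally show ?thesis using u by (simp add: field_simps)
qed (use assms in auto)

text \<open>Jensen's inequality for a weight of arbitrary mass \<open>W\<close>: the concave power
  is bounded by its tangent at the weighted mean, and integrating against \<open>w\<close> turns the
  tangent into its value at the mean.\<close>

lemma integral_powr_le:
  fixes w X :: "real \<Rightarrow> real"
  assumes w: "continuous_on {0..1} w" "\<And>s. s \<in> {0..1} \<Longrightarrow> 0 \<le> w s"
    and X: "continuous_on {0..1} X" "\<And>s. s \<in> {0..1} \<Longrightarrow> 0 \<le> X s"
    and W: "(w has_integral W) {0..1}" "0 < W"
    and T: "((\<lambda>s. w s * X s) has_integral T) {0..1}"
    and r: "0 < r" "r \<le> 1"
  shows "integral {0..1} (\<lambda>s. w s * X s powr r) \<le> W powr (1 - r) * T powr r"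
proof (cases "T = 0")
  case True
  \<comment> \<open>The mean is 0 and cannot be divided by. A nonnegative continuous integrand with
    zero integral vanishes pointwise, so \<open>w s\<close> or \<open>X s\<close> is 0, and
    \<open>0 powr r = 0\<close> carries this over.\<close>
  have "\<forall>s\<in>{0..1}. w s * X s = 0"
    using integral_eq_0_iff[of 0 1 "\<lambda>s. w s * X s"] T True w X
    by (auto intro!: continuous_intros simp: integral_unique)
  then have "((\<lambda>s. w s * X s powr r) has_integral 0) {0..1}"
    by (intro has_integral_is_0) auto
  then show ?thesis by (simp add: integral_unique True)
next
  case False
  have "0 \<le> T" using has_integral_nonneg[OF T] w X by simp
  with False have T0: "0 < T" by simp
  define \<mu> where "\<mu> = T / W"
  have \<mu>: "0 < \<mu>" using T0 W by (simp add: \<mu>_def)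
  have tangent: "((\<lambda>s. \<mu> powr r * ((1 - r) * w s + r / \<mu> * (w s * X s))) has_integral
      \<mu> powr r * ((1 - r) * W + r / \<mu> * T)) {0..1}"
    by (intro has_integral_add has_integral_mult_right W T)
  have "integral {0..1} (\<lambda>s. w s * X s powr r) \<le> \<mu> powr r * ((1 - r) * W + r / \<mu> * T)"
  proof (rule has_integral_le[OF integrable_integral tangent])
    show "(\<lambda>s. w s * X s powr r) integrable_on {0..1}"
      using w X r
      by (intro integrable_continuous_real continuous_intros continuous_on_powr') auto
    fix s :: real assume s: "s \<in> {0..1}"
    have "X s powr r = \<mu> powr r * (X s / \<mu>) powr r"
      using X s \<mu> by (simp add: powr_divide)
    also have "\<dots> \<le> \<mu> powr r * (1 + r * (X s / \<mu> - 1))"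
      using X s \<mu> r by (intro mult_left_mono powr_le_tangent) auto
    finally have "w s * X s powr r \<le> w s * (\<mu> powr r * (1 + r * (X s / \<mu> - 1)))"
      using w s by (intro mult_left_mono) auto
    then show "w s * X s powr r \<le> \<mu> powr r * ((1 - r) * w s + r / \<mu> * (w s * X s))"
      by (simp add: algebra_simps)
  qed
  also have "r / \<mu> * T = r * W"
    using T0 by (simp add: \<mu>_def)
  also have "\<mu> powr r * ((1 - r) * W + r * W) = \<mu> powr r * W"
    by (simp add: algebra_simps)
  also have "\<dots> = W powr (1 - r) * T powr r"
    using T0 W by (simp add: \<mu>_def powr_divide powr_diff)
  finally show ?thesis .
qed

section \<open>Closed forms behind the two brackets of the theorem\<close>

lemma has_integral_parabola_exp:
  fixes L :: real
  assumes "L \<noteq> 0"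
  shows "((\<lambda>s. (s\<^sup>2 - s + 1 / 2) * exp (L * s)) has_integral
           (2 * exp L - 2) / L ^ 3 - (exp L + 1) / L ^ 2 - (1 - exp L) / (2 * L)) {0..1}"
proof -
  \<comment> \<open>Repeated integration by parts: for the quadratic weight \<open>W\<close>, the
    factor of the exponential is \<open>W / L - W' / L^2 + W'' / L^3\<close>.\<close>
  define P where "P s = exp (L * s) * ((s\<^sup>2 - s + 1 / 2) / L - (2 * s - 1) / L ^ 2 + 2 / L ^ 3)" for s
  have "(P has_real_derivative (s\<^sup>2 - s + 1 / 2) * exp (L * s)) (at s within {0..1})" for s
    unfolding P_def using assms
    by (auto intro!: derivative_eq_intros simp: field_simps power2_eq_square power3_eq_cube)
  then have "((\<lambda>s. (s\<^sup>2 - s + 1 / 2) * exp (L * s)) has_integral P 1 - P 0) {0..1}"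
    by (intro fundamental_theorem_of_calculus)
      (auto simp: has_real_derivative_iff_has_vector_derivative[symmetric])
  moreover have "P 1 - P 0 = (2 * exp L - 2) / L ^ 3 - (exp L + 1) / L ^ 2 - (1 - exp L) / (2 * L)"
    using assms by (simp add: P_def field_simps power2_eq_square power3_eq_cube)
  ultimately show ?thesis by simp
qed

lemma has_integral_centered_exp:
  fixes L :: real
  assumes "L \<noteq> 0"
  shows "((\<lambda>s. (1 / 2 - s) * exp (L * s)) has_integral
           (exp L - 1) / L ^ 2 - (exp L + 1) / (2 * L)) {0..1}"
proof -
  define P where "P s = exp (L * s) * ((1 / 2 - s) / L + 1 / L ^ 2)" for s
  have "(P has_real_derivative (1 / 2 - s) * exp (L * s)) (at s within {0..1})" for s
    unfolding P_def using assms
    by (auto intro!: derivative_eq_intros simp: field_simps power2_eq_square)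
  then have "((\<lambda>s. (1 / 2 - s) * exp (L * s)) has_integral P 1 - P 0) {0..1}"
    by (intro fundamental_theorem_of_calculus)
      (auto simp: has_real_derivative_iff_has_vector_derivative[symmetric])
  moreover have "P 1 - P 0 = (exp L - 1) / L ^ 2 - (exp L + 1) / (2 * L)"
    using assms by (simp add: P_def field_simps power2_eq_square)
  ultimately show ?thesis by simp
qed

section \<open>Pairing s with 1 - s, and the masses of the weights\<close>

text \<open>Adding the integrand at \<open>s\<close> and at \<open>1 - s\<close> gives
  \<open>1 / 2 - s\<close> times a difference of exponentials. For \<open>L \<le> 0\<close> both
  factors have the same sign, so absolute values cost nothing. The weight becomes nonnegative, as
  Jensen requires; the factor 2 counts both reflected copies.\<close>

lemma integral_centered_exp_symmetric:
  fixes L :: real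
  assumes "L \<le> 0"
  shows "((\<lambda>s. \<bar>1 / 2 - s\<bar> * \<bar>exp (L * s) - exp (L * (1 - s))\<bar>) has_integral
           2 * integral {0..1} (\<lambda>s. (1 / 2 - s) * exp (L * s))) {0..1}"
proof -
  define h where "h s = (1 / 2 - s) * exp (L * s)" for s
  have h: "(h has_integral integral {0..1} h) {0..1}"
    unfolding h_def by (intro integrable_integral integrable_continuous_real continuous_intros)
  have "((\<lambda>s. h (- 1 *\<^sub>R s + 1)) has_integral integral {0..1} h) ((\<lambda>x. 1 - x) ` {0..1})"
    using has_integral_affinity01[OF h, of "-1" 1] by simp
  also have "(\<lambda>x. 1 - x) ` {0..1} = {0..1::real}"
    by (simp add: image_diff_atLeastAtMost)
  finally have sum: "((\<lambda>s. h s + h (- 1 *\<^sub>R s + 1)) has_integral integral {0..1} h + integral {0..1} h) {0..1}"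
    by (intro has_integral_add h)
  have "\<bar>1 / 2 - s\<bar> * \<bar>exp (L * s) - exp (L * (1 - s))\<bar> = h s + h (- 1 *\<^sub>R s + 1)" for s
  proof (cases "s \<le> 1 / 2")
    case True
    then have "exp (L * (1 - s)) \<le> exp (L * s)"
      using assms by (auto intro: mult_left_mono_neg)
    then show ?thesis using True by (simp add: h_def algebra_simps)
  next
    case False
    then have "exp (L * s) \<le> exp (L * (1 - s))"
      using assms by (auto intro: mult_left_mono_neg)
    then show ?thesis using False by (simp add: h_def algebra_simps)
  qed
  moreover have "h = (\<lambda>s. (1 / 2 - s) * exp (L * s))"
    by (simp add: h_def fun_eq_iff)
  ultimately show ?thesis using sum by simp
qed

lemma integral_centered_exp_nonneg:
  fixes L :: real
  assumes "L \<le> 0"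
  shows "0 \<le> integral {0..1} (\<lambda>s. (1 / 2 - s) * exp (L * s))"
  using has_integral_nonneg[OF integral_centered_exp_symmetric[OF assms]] by simp

lemma has_integral_abs_centered:
  "((\<lambda>s::real. \<bar>1 / 2 - s\<bar>) has_integral 1 / 4) {0..1}"
proof -
  have "((\<lambda>s::real. 1 / 2 - s) has_integral (1 / 2 * (1 / 2) - (1 / 2)\<^sup>2 / 2) - (1 / 2 * 0 - 0\<^sup>2 / 2)) {0..1 / 2}"
    by (intro fundamental_theorem_of_calculus)
      (auto intro!: derivative_eq_intros simp: has_real_derivative_iff_has_vector_derivative[symmetric])
  then have "((\<lambda>s::real. 1 / 2 - s) has_integral 1 / 8) {0..1 / 2}"
    by (simp add: power2_eq_square)
  then have left: "((\<lambda>s::real. \<bar>1 / 2 - s\<bar>) has_integral 1 / 8) {0..1 / 2}"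
    by (rule has_integral_eq[rotated]) auto
  have "((\<lambda>s::real. s - 1 / 2) has_integral (1\<^sup>2 / 2 - 1 / 2 * 1) - ((1 / 2)\<^sup>2 / 2 - 1 / 2 * (1 / 2))) {1 / 2..1}"
    by (intro fundamental_theorem_of_calculus)
      (auto intro!: derivative_eq_intros simp: has_real_derivative_iff_has_vector_derivative[symmetric])
  then have "((\<lambda>s::real. s - 1 / 2) has_integral 1 / 8) {1 / 2..1}"
    by (simp add: power2_eq_square)
  then have right: "((\<lambda>s::real. \<bar>1 / 2 - s\<bar>) has_integral 1 / 8) {1 / 2..1}"
    by (rule has_integral_eq[rotated]) auto
  show ?thesis
    using has_integral_combine[OF _ _ left right] by simp
qed

lemma has_integral_parabola:
  "((\<lambda>s::real. s\<^sup>2 - s + 1 / 2) has_integral 1 / 3) {0..1}"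
proof -
  have "((\<lambda>s::real. s\<^sup>2 - s + 1 / 2) has_integral (1 ^ 3 / 3 - 1\<^sup>2 / 2 + 1 / 2 * 1) - (0 ^ 3 / 3 - 0\<^sup>2 / 2 + 1 / 2 * 0)) {0..1}"
    by (intro fundamental_theorem_of_calculus)
      (auto intro!: derivative_eq_intros simp: has_real_derivative_iff_has_vector_derivative[symmetric])
  then show ?thesis by simp
qed

text \<open>The weight \<open>1 / 2 - s\<close> changes sign, so Jensen is applied to the paired
  form with weight \<open>\<bar>1 / 2 - s\<bar>\<close>.\<close>

lemma integral_centered_exp_le:
  fixes L r :: real
  assumes L: "L \<le> 0" and r: "0 < r" "r \<le> 1"
  shows "integral {0..1} (\<lambda>s. (1 / 2 - s) * exp (r * L * s))
    \<le> (1 / 3) powr (1 - r) * integral {0..1} (\<lambda>s. (1 / 2 - s) * exp (L * s)) powr r"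
    (is "?Dr \<le> _ * ?D powr r")
proof -
  let ?w = "\<lambda>s::real. \<bar>1 / 2 - s\<bar>"
  let ?X = "\<lambda>s. \<bar>exp (L * s) - exp (L * (1 - s))\<bar>"
  have D0: "0 \<le> ?D" by (rule integral_centered_exp_nonneg[OF L])
  \<comment> \<open>Each exponential with rate \<open>r * L\<close> is the \<open>r\<close>-th power
    of the one with rate \<open>L\<close>; subadditivity moves the power outside the
    difference.\<close>
  have diff: "\<bar>exp (r * L * s) - exp (r * L * (1 - s))\<bar> \<le> ?X s powr r" for s
  proof -
    have *: "exp (r * L * t) = exp (L * t) powr r" for t
      by (simp add: powr_def mult_ac)
    show ?thesis
      using powr_diff_le[of "exp (L * (1 - s))" "exp (L * s)" r]
        powr_diff_le[of "exp (L * s)" "exp (L * (1 - s))" r] r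
      unfolding * by (smt (verit) exp_ge_zero powr_mono2)
  qed
  have "2 * ?Dr = integral {0..1} (\<lambda>s. ?w s * \<bar>exp (r * L * s) - exp (r * L * (1 - s))\<bar>)"
    using integral_centered_exp_symmetric[of "r * L"] L r
    by (simp add: integral_unique mult_nonneg_nonpos)
  also have "\<dots> \<le> integral {0..1} (\<lambda>s. ?w s * ?X s powr r)"
  proof (rule integral_le)
    show "(\<lambda>s. ?w s * \<bar>exp (r * L * s) - exp (r * L * (1 - s))\<bar>) integrable_on {0..1}"
      by (intro integrable_continuous_real continuous_intros)
    have "continuous_on {0..1} (\<lambda>s. ?X s powr r)"
      using r by (intro continuous_on_powr' continuous_intros) auto
    then show "(\<lambda>s. ?w s * ?X s powr r) integrable_on {0..1}"
      by (intro integrable_continuous_real continuous_on_mult) (intro continuous_intros)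
  qed (intro mult_left_mono diff abs_ge_zero)
  also have "\<dots> \<le> (1 / 4) powr (1 - r) * (2 * ?D) powr r"
    by (rule integral_powr_le[OF _ _ _ _ has_integral_abs_centered _
          integral_centered_exp_symmetric[OF L] r]) (auto intro!: continuous_intros)
  also have "\<dots> = 2 * ((1 / 8) powr (1 - r) * ?D powr r)"
  proof -
    \<comment> \<open>Here 1/4 is the mass of \<open>\<bar>1 / 2 - s\<bar>\<close>. Writing it as
      2/8 collects the powers of 2 into exactly one factor 2, which cancels the pairing.\<close>
    have "(1 / 4) powr (1 - r) = (1 / 8) powr (1 - r) * (2::real) powr (1 - r)"
      by (simp flip: powr_mult)
    moreover have "(2::real) powr (1 - r) * 2 powr r = 2"
      by (simp flip: powr_add)
    ultimately show ?thesis using D0 by (simp add: powr_mult)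
  qed
  finally have "?Dr \<le> (1 / 8) powr (1 - r) * ?D powr r" by simp
  \<comment> \<open>The constant 1/8 is relaxed to 1/3, the mass of the parabola, so that both terms
    of the theorem share one prefactor.\<close>
  also have "\<dots> \<le> (1 / 3) powr (1 - r) * ?D powr r"
    using r by (intro mult_right_mono powr_mono2) auto
  finally show ?thesis .
qed

section \<open>The kernel estimate for a derivative of constant sign\<close>

text \<open>For positive \<open>p\<close>, the two signs of \<open>E\<close> are bounded separately,
  with weights \<open>(1 - s)^2 / 2\<close> and \<open>s^2 / 2\<close>. Their exponential integrals
  are half the sum and half the difference of the two closed-form integrals. Negative
  \<open>p\<close> reduces to this by negating \<open>p\<close> and \<open>E\<close>.\<close>

lemma abs_integral_centered_le:
  fixes p :: "real \<Rightarrow> real"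
  assumes E: "((\<lambda>s. (1 / 2 - s) * p s) has_integral E) {0..1}"
    and bound: "\<And>s. s \<in> {0..1} \<Longrightarrow> \<bar>p s\<bar> \<le> M * exp (l * s)"
    and sign: "(\<forall>s\<in>{0..1}. 0 < p s) \<or> (\<forall>s\<in>{0..1}. p s < 0)"
    and l: "l \<le> 0"
  shows "\<bar>E\<bar> \<le> M / 2 * (integral {0..1} (\<lambda>s. (s\<^sup>2 - s + 1 / 2) * exp (l * s))
                     + integral {0..1} (\<lambda>s. (1 / 2 - s) * exp (l * s)))"
    (is "_ \<le> M / 2 * (?A + ?D)")
proof -
  have A: "((\<lambda>s. (s\<^sup>2 - s + 1 / 2) * exp (l * s)) has_integral ?A) {0..1}"
    by (intro integrable_integral integrable_continuous_real continuous_intros)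
  have D: "((\<lambda>s. (1 / 2 - s) * exp (l * s)) has_integral ?D) {0..1}"
    by (intro integrable_integral integrable_continuous_real continuous_intros)
  have D0: "0 \<le> ?D" by (rule integral_centered_exp_nonneg[OF l])
  have "0 \<le> M" using bound[of 0] by simp
  have pos: "\<bar>E\<bar> \<le> M / 2 * (?A + ?D)"
    if E: "((\<lambda>s. (1 / 2 - s) * p s) has_integral E) {0..1}"
      and p: "\<And>s. s \<in> {0..1} \<Longrightarrow> 0 < p s \<and> p s \<le> M * exp (l * s)"
    for p :: "real \<Rightarrow> real" and E
  proof -
    \<comment> \<open>Used with \<open>d\<^sup>2 = s\<^sup>2 - s + 1/2 \<plusminus> (1/2 - s)\<close>, that is, \<open>d = 1 - s\<close> and \<open>d = s\<close>.\<close>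
    have weight: "c * p s \<le> M / 2 * (d\<^sup>2 * exp (l * s))"
      if "s \<in> {0..1}" "2 * c \<le> d\<^sup>2" for c d s
    proof -
      have "c * p s \<le> d\<^sup>2 / 2 * p s"
        using that p[of s] by (intro mult_right_mono) auto
      also have "\<dots> \<le> d\<^sup>2 / 2 * (M * exp (l * s))"
        using that p[of s] by (intro mult_left_mono) auto
      finally show ?thesis by (simp add: mult_ac)
    qed
    have "E \<le> M / 2 * (?A + ?D)"
    proof (rule has_integral_le[OF E has_integral_mult_right[OF has_integral_add[OF A D]]])
      fix s :: real assume "s \<in> {0..1}"
      then have "(1 / 2 - s) * p s \<le> M / 2 * ((1 - s)\<^sup>2 * exp (l * s))"
        by (rule weight) (simp add: power2_eq_square algebra_simps)
      then show "(1 / 2 - s) * p s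
          \<le> M / 2 * ((s\<^sup>2 - s + 1 / 2) * exp (l * s) + (1 / 2 - s) * exp (l * s))"
        by (simp add: power2_eq_square algebra_simps)
    qed
    moreover have "- E \<le> M / 2 * (?A - ?D)"
    proof (rule has_integral_le[OF has_integral_neg[OF E]
          has_integral_mult_right[OF has_integral_diff[OF A D]]])
      fix s :: real assume "s \<in> {0..1}"
      moreover have "2 * (s - 1 / 2) \<le> s\<^sup>2"
        using zero_le_power2[of "s - 1"] by (simp add: power2_eq_square algebra_simps)
      ultimately have "(s - 1 / 2) * p s \<le> M / 2 * (s\<^sup>2 * exp (l * s))"
        by (rule weight)
      then show "- ((1 / 2 - s) * p s)
          \<le> M / 2 * ((s\<^sup>2 - s + 1 / 2) * exp (l * s) - (1 / 2 - s) * exp (l * s))"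
        by (simp add: algebra_simps)
    qed
    \<comment> \<open>Since \<open>l \<le> 0\<close> puts more exponential mass on the left half,
      \<open>?D\<close> is nonnegative and the bound for \<open>E\<close> also covers
      \<open>- E\<close>.\<close>
    moreover have "M / 2 * (?A - ?D) \<le> M / 2 * (?A + ?D)"
      using D0 \<open>0 \<le> M\<close> by (intro mult_left_mono) auto
    ultimately show ?thesis by linarith
  qed
  from sign show ?thesis
  proof
    assume "\<forall>s\<in>{0..1}. 0 < p s"
    then show ?thesis using pos[OF E] bound by force
  next
    assume "\<forall>s\<in>{0..1}. p s < 0"
    moreover have "((\<lambda>s. (1 / 2 - s) * - p s) has_integral - E) {0..1}"
      using has_integral_neg[OF E] by simp
    ultimately show ?thesis using pos[of "\<lambda>s. - p s" "- E"] bound by force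
  qed
qed

section \<open>The trapezoid estimate from logarithmic convexity\<close>

theorem theorem3:
  fixes I :: "real set" and f :: "real \<Rightarrow> real"
    and a b \<alpha> m q \<eta> \<phi> :: real
  assumes "open I" and "is_interval I" and "{0..} \<subseteq> I"
    and "\<And>x. x \<in> I \<Longrightarrow> 0 < f x"
    and "f differentiable_on I"
    and "0 \<le> a" and "a < b"
    and "set_integrable lebesgue {a<..<b} (deriv f)"
    and "0 < \<alpha>" and "\<alpha> \<le> 1" and "0 < m" and "m \<le> 1" and "1 \<le> q"
    and "log_convex_am \<alpha> m (b / m) (\<lambda>x. \<bar>deriv f x\<bar> powr q)"
    and "\<eta> = \<bar>deriv f a\<bar> / \<bar>deriv f (b / m)\<bar> powr m"
    and "\<phi> = \<eta> powr (\<alpha> * q)"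
  shows "(\<eta> = 1 \<longrightarrow>
           \<bar>(f a + f b) / 2 - 1 / (b - a) * integral {a..b} f\<bar>
             \<le> (b - a) / 3 * \<bar>deriv f (b / m)\<bar> powr m) \<and>
         (\<eta> < 1 \<longrightarrow>
           \<bar>(f a + f b) / 2 - 1 / (b - a) * integral {a..b} f\<bar>
             \<le> (b - a) / 2 * (1 / 3) powr (1 - 1 / q) * \<bar>deriv f (b / m)\<bar> powr m *
               (((2 * \<phi> - 2) / (ln \<phi>) ^ 3 - (\<phi> + 1) / (ln \<phi>) ^ 2
                   - (1 - \<phi>) / (2 * ln \<phi>)) powr (1 / q)
                + ((\<phi> - 1) / (ln \<phi>) ^ 2 - (\<phi> + 1) / (2 * ln \<phi>)) powr (1 / q)))"
proof -
  define M where "M = \<bar>deriv f (b / m)\<bar> powr m"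
  define l where "l = \<alpha> * ln \<eta>"
  define p where "p s = deriv f (s * a + (1 - s) * b)" for s
  define E where "E = ((f a + f b) / 2 - 1 / (b - a) * integral {a..b} f) / (b - a)"
  note lc = \<open>log_convex_am \<alpha> m (b / m) (\<lambda>x. \<bar>deriv f x\<bar> powr q)\<close>[unfolded log_convex_am_def]
  have "b \<le> b / m"
    using \<open>0 \<le> a\<close> \<open>a < b\<close> \<open>0 < m\<close> \<open>m \<le> 1\<close> by (simp add: field_simps mult_left_le)
  then have am: "a \<in> {0..b / m}" and bm: "b / m \<in> {0..b / m}"
    using \<open>0 \<le> a\<close> \<open>a < b\<close> by auto
  \<comment> \<open>Logarithmic convexity includes strict positivity, and
    \<open>0 powr q = 0\<close> would violate it.\<close>
  have nz: "deriv f x \<noteq> 0" if "x \<in> {0..b / m}" for x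
    using lc that by fastforce
  have der: "(f has_real_derivative deriv f x) (at x)" if "x \<in> {a..b}" for x
  proof -
    have "x \<in> I" using that \<open>0 \<le> a\<close> \<open>{0..} \<subseteq> I\<close> by auto
    then have "f differentiable at x"
      using \<open>f differentiable_on I\<close> \<open>open I\<close> differentiable_on_eq_differentiable_at by blast
    then show ?thesis by (simp add: DERIV_deriv_iff_real_differentiable)
  qed
  have segment: "s * a + (1 - s) * b \<in> {a..b}" if "s \<in> {0..1}" for s
    using convexD[of "{a..b}" a b s "1 - s"] that \<open>a < b\<close> by simp
  have "M > 0" and A: "0 < \<bar>deriv f a\<bar>" and B: "0 < \<bar>deriv f (b / m)\<bar>"
    using nz[OF am] nz[OF bm] by (auto simp: M_def)
  have \<eta>: "\<eta> = \<bar>deriv f a\<bar> / M" "0 < \<eta>"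
    using A \<open>M > 0\<close> \<open>\<eta> = _\<close> by (auto simp: M_def)
  have "(\<forall>x\<in>{a..b}. 0 < deriv f x) \<or> (\<forall>x\<in>{a..b}. deriv f x < 0)"
    using der nz \<open>0 \<le> a\<close> \<open>b \<le> b / m\<close> by (intro derivative_nonzero_constant_sign) auto
  then have sign: "(\<forall>s\<in>{0..1}. 0 < p s) \<or> (\<forall>s\<in>{0..1}. p s < 0)"
    using segment by (auto simp: p_def)
  have E: "((\<lambda>s. (1 / 2 - s) * p s) has_integral E) {0..1}"
    unfolding p_def E_def
    using der by (intro trapezoid_error_has_integral \<open>a < b\<close>) (auto intro: has_field_derivative_at_within)
  have bound: "\<bar>p s\<bar> \<le> M * exp (l * s)" if s: "s \<in> {0..1}" and "\<eta> \<le> 1" for s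
  proof -
    define T where "T = s powr \<alpha>"
    \<comment> \<open>Convexity is used at the points \<open>a\<close> and \<open>b / m\<close>: the
      factor \<open>m\<close> in its argument cancels, leaving
      \<open>s * a + (1 - s) * b\<close>.\<close>
    have "\<bar>p s\<bar> powr q \<le> (\<bar>deriv f a\<bar> powr q) powr T * (\<bar>deriv f (b / m)\<bar> powr q) powr (m * (1 - T))"
      using lc am bm s \<open>0 < m\<close> by (fastforce simp: p_def T_def mult_ac)
    also have "\<dots> = (\<bar>deriv f a\<bar> powr T * M powr (1 - T)) powr q"
      by (simp add: M_def powr_mult powr_powr mult_ac)
    finally have "\<bar>p s\<bar> \<le> \<bar>deriv f a\<bar> powr T * M powr (1 - T)"
      using powr_less_mono2[of q "\<bar>deriv f a\<bar> powr T * M powr (1 - T)" "\<bar>p s\<bar>"] \<open>1 \<le> q\<close>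
      by (meson leD linorder_le_less_linear mult_nonneg_nonneg powr_ge_zero less_le_trans zero_less_one)
    also have "\<dots> = M * \<eta> powr T"
      using \<open>M > 0\<close> by (simp add: \<eta>(1) powr_divide powr_diff)
    also have "\<eta> powr T = exp (T * ln \<eta>)"
      using \<open>0 < \<eta>\<close> by (simp add: powr_def)
    \<comment> \<open>On [0,1] the power \<open>s powr \<alpha>\<close> dominates \<open>s\<close>,
      hence \<open>\<alpha> * s\<close>. Since \<open>ln \<eta> \<le> 0\<close>, the order reverses
      on multiplication, and the exponent becomes linear in \<open>s\<close>.\<close>
    also have "\<alpha> * s \<le> T"
    proof -
      have "\<alpha> * s \<le> s" using s \<open>\<alpha> \<le> 1\<close> by (simp add: mult_left_le_one_le \<open>0 < \<alpha>\<close> less_imp_le)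
      also have "s \<le> T" using powr_mono'[of \<alpha> 1 s] s \<open>\<alpha> \<le> 1\<close> by (simp add: T_def)
      finally show ?thesis .
    qed
    then have "T * ln \<eta> \<le> l * s"
      using mult_right_mono_neg[of "\<alpha> * s" T "ln \<eta>"] \<open>0 < \<eta>\<close> \<open>\<eta> \<le> 1\<close>
      by (simp add: l_def mult_ac)
    then have "M * exp (T * ln \<eta>) \<le> M * exp (l * s)"
      using \<open>M > 0\<close> by simp
    finally show ?thesis .
  qed
  have l: "l \<le> 0" if "\<eta> \<le> 1"
    using that \<open>0 < \<eta>\<close> \<open>0 < \<alpha>\<close> by (simp add: l_def mult_nonneg_nonpos)
  have err: "\<bar>(f a + f b) / 2 - 1 / (b - a) * integral {a..b} f\<bar>
      \<le> (b - a) / 2 * M * (integral {0..1} (\<lambda>s. (s\<^sup>2 - s + 1 / 2) * exp (l * s))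
          + integral {0..1} (\<lambda>s. (1 / 2 - s) * exp (l * s)))" (is "\<bar>?err\<bar> \<le> _ * (?A + ?D)")
    if "\<eta> \<le> 1"
  proof -
    have "?err = (b - a) * E" using \<open>a < b\<close> by (simp add: E_def)
    then have "\<bar>?err\<bar> = (b - a) * \<bar>E\<bar>" using \<open>a < b\<close> by (simp add: abs_mult)
    also have "\<dots> \<le> (b - a) * (M / 2 * (?A + ?D))"
      using abs_integral_centered_le[OF E bound sign l] that \<open>a < b\<close> by (intro mult_left_mono) auto
    finally show ?thesis by simp
  qed
  show ?thesis
    unfolding M_def[symmetric]
  proof (intro conjI impI)
    assume "\<eta> = 1"
    then have "l = 0" by (simp add: l_def)
    have "((\<lambda>s::real. 1 / 2 - s) has_integral (1 / 2 * 1 - 1\<^sup>2 / 2) - (1 / 2 * 0 - 0\<^sup>2 / 2)) {0..1}"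
      by (intro fundamental_theorem_of_calculus)
        (auto intro!: derivative_eq_intros simp: has_real_derivative_iff_has_vector_derivative[symmetric])
    then have "integral {0..1} (\<lambda>s::real. 1 / 2 - s) = 0"
      by (simp add: integral_unique)
    \<comment> \<open>With \<open>l = 0\<close> the weights contribute 1/3 and 0, giving
      \<open>(b - a) / 6 * M\<close>; nonnegativity relaxes this to the stated bound.\<close>
    moreover have "0 \<le> (b - a) * M" using \<open>a < b\<close> \<open>M > 0\<close> by simp
    ultimately show "\<bar>(f a + f b) / 2 - 1 / (b - a) * integral {a..b} f\<bar> \<le> (b - a) / 3 * M"
      using err \<open>\<eta> = 1\<close> \<open>l = 0\<close> integral_unique[OF has_integral_parabola] by simp
  next
    assume "\<eta> < 1"
    define L where "L = ln \<phi>"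
    define r where "r = 1 / q"
    have r: "0 < r" "r \<le> 1" using \<open>1 \<le> q\<close> by (auto simp: r_def)
    have \<phi>: "\<phi> = exp L" and L_eq: "L = q * l"
      using \<open>0 < \<eta>\<close> \<open>\<phi> = _\<close> by (auto simp: L_def l_def ln_powr powr_def)
    have "l < 0"
      using \<open>\<eta> < 1\<close> \<open>0 < \<eta>\<close> \<open>0 < \<alpha>\<close> by (simp add: l_def mult_pos_neg)
    \<comment> \<open>Strict negativity makes the divisions by powers of \<open>L\<close>
      legitimate, and \<open>r * L = l\<close> exhibits \<open>exp (l * s)\<close> as the
      \<open>1 / q\<close>-th power of \<open>exp (L * s)\<close>, which is
      \<open>\<phi> powr s\<close>.\<close>
    have L: "L < 0" "r * L = l"
      using \<open>l < 0\<close> \<open>1 \<le> q\<close> by (auto simp: L_eq r_def mult_pos_neg)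
    let ?J = "(2 * \<phi> - 2) / L ^ 3 - (\<phi> + 1) / L ^ 2 - (1 - \<phi>) / (2 * L)"
    let ?K = "(\<phi> - 1) / L ^ 2 - (\<phi> + 1) / (2 * L)"
    have J: "((\<lambda>s. (s\<^sup>2 - s + 1 / 2) * exp (L * s)) has_integral ?J) {0..1}"
      unfolding \<phi> using L by (intro has_integral_parabola_exp) auto
    have K: "((\<lambda>s. (1 / 2 - s) * exp (L * s)) has_integral ?K) {0..1}"
      unfolding \<phi> using L by (intro has_integral_centered_exp) auto
    have weight_nonneg: "0 \<le> s\<^sup>2 - s + 1 / 2" for s :: real
      using zero_le_power2[of "s - 1 / 2"] by (simp add: power2_eq_square algebra_simps)
    have "integral {0..1} (\<lambda>s. (s\<^sup>2 - s + 1 / 2) * exp (L * s) powr r) \<le> (1 / 3) powr (1 - r) * ?J powr r"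
      using weight_nonneg
      by (intro integral_powr_le[OF _ _ _ _ has_integral_parabola _ J r])
        (auto intro!: continuous_intros)
    moreover have "exp (L * s) powr r = exp (l * s)" for s
      by (simp add: powr_def flip: L(2))
    ultimately have "integral {0..1} (\<lambda>s. (s\<^sup>2 - s + 1 / 2) * exp (l * s)) \<le> (1 / 3) powr (1 - r) * ?J powr r"
      by simp
    moreover have "integral {0..1} (\<lambda>s. (1 / 2 - s) * exp (l * s)) \<le> (1 / 3) powr (1 - r) * ?K powr r"
      using integral_centered_exp_le[of L r] L r integral_unique[OF K] by simp
    ultimately have "(b - a) / 2 * M * (integral {0..1} (\<lambda>s. (s\<^sup>2 - s + 1 / 2) * exp (l * s))
          + integral {0..1} (\<lambda>s. (1 / 2 - s) * exp (l * s)))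
        \<le> (b - a) / 2 * M * ((1 / 3) powr (1 - r) * ?J powr r + (1 / 3) powr (1 - r) * ?K powr r)"
      using \<open>a < b\<close> \<open>M > 0\<close> by (intro mult_left_mono add_mono) auto
    also have "\<dots> = (b - a) / 2 * (1 / 3) powr (1 - r) * M * (?J powr r + ?K powr r)"
      by (simp add: algebra_simps)
    finally show "\<bar>(f a + f b) / 2 - 1 / (b - a) * integral {a..b} f\<bar>
        \<le> (b - a) / 2 * (1 / 3) powr (1 - 1 / q) * M *
          (((2 * \<phi> - 2) / (ln \<phi>) ^ 3 - (\<phi> + 1) / (ln \<phi>) ^ 2 - (1 - \<phi>) / (2 * ln \<phi>)) powr (1 / q)
            + ((\<phi> - 1) / (ln \<phi>) ^ 2 - (\<phi> + 1) / (2 * ln \<phi>)) powr (1 / q))"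
      using err \<open>\<eta> < 1\<close> unfolding L_def[symmetric] r_def[symmetric] by linarith
  qed
qed

end
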